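(* Let $\rho=(\rho_1,\dots,\rho_d):\bar{\mathcal S}\to\mathbb R^d$ be the drift field, $\rho(y)=\sum_{e\in\mathcal E_y}\nu_e\lambda_e$. Suppose that for each $i=1,\dots,d$ there exists a symmetry $\phi_i$ of $L$ such that $\phi_i^*\rho_i=-\rho_i$ and $\phi_i^{-1}=\phi_i$. Then the null drift condition holds: $$\sum_{y\in\bar{\mathcal S}}\rho(y)\pi(y)=0.$$
   Context: A weighted directed graph is a triple $(\mathcal S,\mathcal E,\lambda)$ with $\mathcal S\subset\mathbb R^d$ a countable set of nodes, $\mathcal E\subset\mathcal S\times\mathcal S$ the directed edges, and $\lambda:\mathcal E\to(0,\infty)$; write $\lambda_e=\lambda(e)$. Standing assumptions: the graph is strongly connected, has no edges of the form $(y,y)$, and is invariant under integer translations (for $n\in\mathbb Z^d$: $x\in\mathcal S\Rightarrow x+n\in\mathcal S$; $(x,y)\in\mathcal E\Rightarrow(x+n,y+n)\in\mathcal E$ and $\lambda(x+n,y+n)=\lambda(x,y)$). For $e=(x,y)\in\mathcal E$: $\partial_-e=x$, $\partial_+e=y$, $\nu_e=y-x$. For $y\in\mathcal S$: $\mathcal E_y=\{e\in\mathcal E:\partial_-e=y\}$. $\bar{\mathcal S}$ is the quotient of $\mathcal S$ by $\mathbb Z^d$-translations, identified with $\mathcal S\cap[0,1)^d$. $\bar{\mathcal E}$ is the quotient of $\mathcal E$ by simultaneous translation of both endpoints by the same element of $\mathbb Z^d$, identified with $\bigcup_{y\in\bar{\mathcal S}}\mathcal E_y$. Both $\bar{\mathcal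 S}$ and $\bar{\mathcal E}$ are assumed finite. $(Lf)(y)=\sum_{e\in\mathcal E_y}(f(y+\nu_e)-f(y))\lambda_e$ for $f:\bar{\mathcal S}\to\mathbb R$, $y\in\bar{\mathcal S}$, with $y+\nu_e$ taken modulo $\mathbb Z^d$; its matrix entries are $L(x,y)=(L\delta_y)(x)$. $L^T$ is the transpose; $\pi$ is the unique function on $\bar{\mathcal S}$ with $L^T\pi=0$, $\sum_{y\in\bar{\mathcal S}}\pi(y)=1$. For a bijection $\phi:\bar{\mathcal S}\to\bar{\mathcal S}$, the pull-back is $\phi^*f=f\circ\phi$ for $f:\bar{\mathcal S}\to\mathbb R$. The bijection $\phi$ is a symmetry of $L$ if $L(\phi(x),\phi(y))=L(x,y)$ for all $x,y\in\bar{\mathcal S}$ (equivalently $L\circ\phi^*=\phi^*\circ L$). *)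

theory Defs
  imports "HOL-Analysis.Analysis"
begin

text \<open>
  Periodic weighted directed graphs in \<open>\<real>\<^sup>d\<close>, with \<open>d\<close> the cardinality of the index type \<open>'d\<close>.
  The edge weight \<open>lam\<close> is a total function; only its values on \<open>E\<close> are relevant.
\<close>

type_synonym 'd edge = "(real ^ 'd) \<times> (real ^ 'd)"

definition int_vecs :: "(real ^ 'd) set" where
  "int_vecs = {n. \<forall>i. n $ i \<in> \<int>}"

definition nu :: "'d edge \<Rightarrow> real ^ 'd" where
  "nu e = snd e - fst e"

definition out_edges :: "'d edge set \<Rightarrow> real ^ 'd \<Rightarrow> 'd edge set" where
  "out_edges E y = {e \<in> E. fst e = y}"

text \<open>
  The quotient of \<open>S\<close> by integer translations is represented by \<open>S \<inter> [0,1)\<^sup>d\<close>, and the quotient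
  of \<open>E\<close> by the edges that start there. Functions on the quotient are total functions on
  \<open>real ^ 'd\<close>; only their values on \<open>node_cell S\<close> are relevant.
\<close>

definition node_cell :: "(real ^ 'd) set \<Rightarrow> (real ^ 'd) set" where
  "node_cell S = {x \<in> S. \<forall>i. 0 \<le> x $ i \<and> x $ i < 1}"

definition edge_cell :: "(real ^ 'd) set \<Rightarrow> 'd edge set \<Rightarrow> 'd edge set" where
  "edge_cell S E = (\<Union>y \<in> node_cell S. out_edges E y)"

text \<open>Reduction modulo integer translations to the representative in \<open>[0,1)\<^sup>d\<close>.\<close>

definition wrap :: "real ^ 'd \<Rightarrow> real ^ 'd" where
  "wrap x = (\<chi> i. frac (x $ i))"

locale periodic_graph =
  fixes S :: "(real ^ 'd) set"
    and E :: "'d edge set"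
    and lam :: "'d edge \<Rightarrow> real"
  assumes countable_nodes: "countable S"
    and edges_subset: "E \<subseteq> S \<times> S"
    and lam_pos: "\<And>e. e \<in> E \<Longrightarrow> lam e > 0"
    and strongly_connected: "\<And>x y. x \<in> S \<Longrightarrow> y \<in> S \<Longrightarrow> (x, y) \<in> E\<^sup>*"
    and no_loops: "\<And>y. (y, y) \<notin> E"
    and nodes_translate: "\<And>n x. n \<in> int_vecs \<Longrightarrow> x \<in> S \<Longrightarrow> x + n \<in> S"
    and edges_translate: "\<And>n x y. n \<in> int_vecs \<Longrightarrow> (x, y) \<in> E \<Longrightarrow> (x + n, y + n) \<in> E"
    and lam_translate:
      "\<And>n x y. n \<in> int_vecs \<Longrightarrow> (x, y) \<in> E \<Longrightarrow> lam (x + n, y + n) = lam (x, y)"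
    and finite_node_cell: "finite (node_cell S)"
    and finite_edge_cell: "finite (edge_cell S E)"

definition gen ::
    "'d edge set \<Rightarrow> ('d edge \<Rightarrow> real) \<Rightarrow> (real ^ 'd \<Rightarrow> real) \<Rightarrow> (real ^ 'd \<Rightarrow> real)" where
  "gen E lam f y = (\<Sum>e \<in> out_edges E y. (f (wrap (y + nu e)) - f y) * lam e)"

definition gen_entry ::
    "'d edge set \<Rightarrow> ('d edge \<Rightarrow> real) \<Rightarrow> real ^ 'd \<Rightarrow> real ^ 'd \<Rightarrow> real" where
  "gen_entry E lam x y = gen E lam (\<lambda>z. if z = y then 1 else 0) x"

definition gen_transpose ::
    "(real ^ 'd) set \<Rightarrow> 'd edge set \<Rightarrow> ('d edge \<Rightarrow> real)
      \<Rightarrow> (real ^ 'd \<Rightarrow> real) \<Rightarrow> (real ^ 'd \<Rightarrow> real)" where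
  "gen_transpose S E lam p y = (\<Sum>x \<in> node_cell S. gen_entry E lam x y * p x)"

text \<open>
  In a periodic graph these two conditions determine the values of \<open>p\<close> on \<open>node_cell S\<close> uniquely;
  nonnegativity of \<open>p\<close> is a consequence and not required.
\<close>

definition stationary ::
    "(real ^ 'd) set \<Rightarrow> 'd edge set \<Rightarrow> ('d edge \<Rightarrow> real) \<Rightarrow> (real ^ 'd \<Rightarrow> real) \<Rightarrow> bool" where
  "stationary S E lam p \<longleftrightarrow>
     (\<forall>y \<in> node_cell S. gen_transpose S E lam p y = 0) \<and> (\<Sum>y \<in> node_cell S. p y) = 1"

definition drift :: "'d edge set \<Rightarrow> ('d edge \<Rightarrow> real) \<Rightarrow> real ^ 'd \<Rightarrow> real ^ 'd" where
  "drift E lam y = (\<Sum>e \<in> out_edges E y. lam e *\<^sub>R nu e)"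

definition pullback :: "('a \<Rightarrow> 'a) \<Rightarrow> ('a \<Rightarrow> real) \<Rightarrow> ('a \<Rightarrow> real)" where
  "pullback \<phi> f = f \<circ> \<phi>"

definition symmetry ::
    "(real ^ 'd) set \<Rightarrow> 'd edge set \<Rightarrow> ('d edge \<Rightarrow> real) \<Rightarrow> (real ^ 'd \<Rightarrow> real ^ 'd) \<Rightarrow> bool" where
  "symmetry S E lam \<phi> \<longleftrightarrow>
     bij_betw \<phi> (node_cell S) (node_cell S) \<and>
     (\<forall>x \<in> node_cell S. \<forall>y \<in> node_cell S.
        gen_entry E lam (\<phi> x) (\<phi> y) = gen_entry E lam x y)"

end

theory Submission
  imports Defs
begin

text \<open>
  A symmetry \<open>\<phi>\<close> of the generator \<open>L\<close> permutes its rows and columns simultaneously, so \<open>\<pi> \<circ> \<phi>\<close>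
  is stationary whenever \<open>\<pi>\<close> is. Stationary functions are unique, hence \<open>\<pi> \<circ> \<phi> = \<pi>\<close>. Changing
  variables by \<open>\<phi>\<close> in \<open>\<Sum> \<pi>(y) \<rho>\<^sub>i(y)\<close> then leaves \<open>\<pi>\<close> alone and reverses the sign of \<open>\<rho>\<^sub>i\<close>, so the
  sum is its own negative.

  The substance is uniqueness, with \<open>\<pi>\<close> not known to be nonnegative. The difference of two
  stationary functions is a \<open>q\<close> with \<open>L\<^sup>T q = 0\<close> and \<open>\<Sum> q = 0\<close>. A Markov semigroup contracts the
  \<open>\<ell>\<^sup>1\<close> norm, and its infinitesimal form is that \<open>L\<^sup>T |q| \<ge> 0\<close> pointwise with total \<open>0\<close>; therefore
  \<open>|q|\<close> lies in the kernel as well (\<open>abs_left_kernel\<close>), and so does the positive part of \<open>q\<close>. A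
  nonnegative kernel element with one zero vanishes identically, because zeros propagate backwards
  along the transitions of an irreducible chain (\<open>nonneg_left_kernel_zero\<close>). So either
  \<open>q > 0\<close> everywhere, which \<open>\<Sum> q = 0\<close> forbids, or \<open>q \<le> 0\<close> everywhere, and then \<open>q = 0\<close>.
\<close>

section \<open>Left kernel of an irreducible rate matrix\<close>

definition transitions :: "'a set \<Rightarrow> ('a \<Rightarrow> 'a \<Rightarrow> real) \<Rightarrow> ('a \<times> 'a) set" where
  "transitions A M = {(x, y). x \<in> A \<and> y \<in> A \<and> x \<noteq> y \<and> M x y > 0}"

locale rate_matrix =
  fixes A :: "'a set" and M :: "'a \<Rightarrow> 'a \<Rightarrow> real"
  assumes finite_states: "finite A"
    and off_diagonal_nonneg: "\<And>x y. x \<in> A \<Longrightarrow> y \<in> A \<Longrightarrow> x \<noteq> y \<Longrightarrow> M x y \<ge> 0"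
    and row_sum_zero: "\<And>x. x \<in> A \<Longrightarrow> (\<Sum>y\<in>A. M x y) = 0"
    and irreducible: "\<And>x y. x \<in> A \<Longrightarrow> y \<in> A \<Longrightarrow> (x, y) \<in> (transitions A M)\<^sup>*"
begin

lemma diagonal_nonpos:
  assumes "y \<in> A"
  shows "M y y \<le> 0"
proof -
  have "M y y + (\<Sum>z\<in>A - {y}. M y z) = 0"
    using row_sum_zero[OF assms] sum.remove[OF finite_states assms, of "M y"] by simp
  moreover have "(\<Sum>z\<in>A - {y}. M y z) \<ge> 0"
    using assms by (intro sum_nonneg off_diagonal_nonneg) auto
  ultimately show ?thesis by linarith
qed

text \<open>
  In a balance equation the diagonal is the only entry of the wrong sign, so the triangle
  inequality gives \<open>M\<^sup>T |q| \<ge> 0\<close> in each coordinate. Zero row sums make these coordinates add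
  up to \<open>0\<close>.
\<close>

lemma abs_left_kernel:
  assumes kernel: "\<And>y. y \<in> A \<Longrightarrow> (\<Sum>x\<in>A. M x y * q x) = 0"
    and "y \<in> A"
  shows "(\<Sum>x\<in>A. M x y * \<bar>q x\<bar>) = 0"
proof -
  define g where "g = (\<lambda>y. \<Sum>x\<in>A. M x y * \<bar>q x\<bar>)"
  have g_nonneg: "g y \<ge> 0" if y: "y \<in> A" for y
  proof -
    have "M y y * q y + (\<Sum>x\<in>A - {y}. M x y * q x) = 0"
      using kernel[OF y] sum.remove[OF finite_states y, of "\<lambda>x. M x y * q x"] by simp
    then have "\<bar>M y y * q y\<bar> = \<bar>\<Sum>x\<in>A - {y}. M x y * q x\<bar>"
      by linarith
    also have "\<dots> \<le> (\<Sum>x\<in>A - {y}. \<bar>M x y * q x\<bar>)"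
      by (rule sum_abs)
    also have "\<dots> = (\<Sum>x\<in>A - {y}. M x y * \<bar>q x\<bar>)"
      using y off_diagonal_nonneg by (intro sum.cong) (auto simp: abs_mult)
    finally have "- (M y y * \<bar>q y\<bar>) \<le> (\<Sum>x\<in>A - {y}. M x y * \<bar>q x\<bar>)"
      using diagonal_nonpos[OF y] by (simp add: abs_mult)
    then show ?thesis
      using sum.remove[OF finite_states y, of "\<lambda>x. M x y * \<bar>q x\<bar>"] by (simp add: g_def)
  qed
  have "(\<Sum>y\<in>A. g y) = (\<Sum>x\<in>A. (\<Sum>y\<in>A. M x y) * \<bar>q x\<bar>)"
    unfolding g_def by (subst sum.swap) (simp add: sum_distrib_right)
  also have "\<dots> = 0"
    using row_sum_zero by simp
  finally have "\<forall>y\<in>A. g y = 0"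
    using g_nonneg finite_states by (simp add: sum_nonneg_eq_0_iff)
  then show ?thesis
    using \<open>y \<in> A\<close> by (simp add: g_def)
qed

text \<open>
  At a zero \<open>y\<close> of \<open>p\<close> the balance equation is a vanishing sum of nonnegative inflows, so \<open>p\<close>
  vanishes at every predecessor of \<open>y\<close>; irreducibility makes every state an ancestor of \<open>y\<close>.
\<close>

lemma nonneg_left_kernel_zero:
  assumes kernel: "\<And>y. y \<in> A \<Longrightarrow> (\<Sum>x\<in>A. M x y * p x) = 0"
    and nonneg: "\<And>x. x \<in> A \<Longrightarrow> p x \<ge> 0"
    and "y \<in> A" "p y = 0" "x \<in> A"
  shows "p x = 0"
proof -
  have predecessor: "p u = 0" if uv: "(u, v) \<in> transitions A M" and "p v = 0" for u v
  proof -
    have u: "u \<in> A" "u \<noteq> v" "M u v > 0" and v: "v \<in> A"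
      using uv by (auto simp: transitions_def)
    have inflow: "M w v * p w \<ge> 0" if "w \<in> A" for w
      using that v nonneg off_diagonal_nonneg \<open>p v = 0\<close> by (cases "w = v") auto
    have "M u v * p u = 0"
      using kernel[OF v] inflow u(1) finite_states by (simp add: sum_nonneg_eq_0_iff)
    then show ?thesis
      using u(3) by simp
  qed
  have "(x, y) \<in> (transitions A M)\<^sup>*"
    using irreducible assms by blast
  then show ?thesis
    by (induction rule: converse_rtrancl_induct) (use \<open>p y = 0\<close> predecessor in blast)+
qed

lemma left_kernel_sum_zero:
  assumes kernel: "\<And>y. y \<in> A \<Longrightarrow> (\<Sum>x\<in>A. M x y * q x) = 0"
    and sum_zero: "(\<Sum>x\<in>A. q x) = 0"
    and "x \<in> A"
  shows "q x = 0"
proof -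
  \<comment> \<open>twice the positive part of \<open>q\<close>\<close>
  define p where "p = (\<lambda>x. \<bar>q x\<bar> + q x)"
  have p_kernel: "(\<Sum>x\<in>A. M x y * p x) = 0" if "y \<in> A" for y
    using kernel[OF that] abs_left_kernel[OF kernel that]
    by (simp add: p_def distrib_left sum.distrib)
  have p_nonneg: "p x \<ge> 0" for x
    by (simp add: p_def)
  show ?thesis
  proof (cases "\<exists>y\<in>A. p y = 0")
    case True
    then have "p z = 0" if "z \<in> A" for z
      using nonneg_left_kernel_zero p_kernel p_nonneg that by blast
    then have "- q z \<ge> 0" if "z \<in> A" for z
      using that by (force simp: p_def)
    moreover have "(\<Sum>z\<in>A. - q z) = 0"
      using sum_zero by (simp add: sum_negf)
    ultimately have "\<forall>z\<in>A. - q z = 0"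
      using finite_states sum_nonneg_eq_0_iff[of A "\<lambda>z. - q z"] by blast
    then show ?thesis
      using \<open>x \<in> A\<close> by simp
  next
    case False
    then have "q z > 0" if "z \<in> A" for z
      using that by (force simp: p_def)
    then have "(\<Sum>z\<in>A. q z) > 0"
      using finite_states \<open>x \<in> A\<close> by (intro sum_pos) auto
    then show ?thesis
      using sum_zero by simp
  qed
qed

end

section \<open>The generator of a periodic graph\<close>

lemma wrap_conv_translate:
  obtains n where "n \<in> int_vecs" "wrap x = x + n"
proof
  show "(\<chi> i. - of_int \<lfloor>x $ i\<rfloor>) \<in> int_vecs"
    by (simp add: int_vecs_def)
  show "wrap x = x + (\<chi> i. - of_int \<lfloor>x $ i\<rfloor>)"
    by (simp add: wrap_def vec_eq_iff frac_def)
qed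

lemma wrap_translate:
  assumes "n \<in> int_vecs"
  shows "wrap (x + n) = wrap x"
  using assms by (auto simp: wrap_def int_vecs_def vec_eq_iff frac_def elim!: Ints_cases)

lemma wrap_node_cell: "x \<in> node_cell S \<Longrightarrow> wrap x = x"
  by (simp add: wrap_def node_cell_def vec_eq_iff frac_eq)

context periodic_graph
begin

lemma wrap_in_node_cell:
  assumes "x \<in> S"
  shows "wrap x \<in> node_cell S"
proof -
  obtain n where "n \<in> int_vecs" "wrap x = x + n"
    by (rule wrap_conv_translate)
  then have "wrap x \<in> S"
    using nodes_translate assms by simp
  then show ?thesis
    by (simp add: node_cell_def wrap_def frac_lt_1)
qed

lemma finite_out_edges:
  assumes "x \<in> node_cell S"
  shows "finite (out_edges E x)"
  using finite_edge_cell by (rule finite_subset[rotated]) (use assms in \<open>auto simp: edge_cell_def\<close>)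

lemma wrap_target_in_node_cell:
  assumes "e \<in> out_edges E x"
  shows "wrap (x + nu e) \<in> node_cell S"
  using assms edges_subset by (intro wrap_in_node_cell) (auto simp: out_edges_def nu_def)

lemma gen_entry_off_diagonal:
  assumes "x \<noteq> y"
  shows "gen_entry E lam x y = (\<Sum>e\<in>out_edges E x. if wrap (x + nu e) = y then lam e else 0)"
  unfolding gen_entry_def gen_def using assms by (intro sum.cong) auto

lemma gen_entry_row_sum:
  assumes x: "x \<in> node_cell S"
  shows "(\<Sum>y\<in>node_cell S. gen_entry E lam x y) = 0"
proof -
  have "(\<Sum>y\<in>node_cell S. gen_entry E lam x y) =
      (\<Sum>e\<in>out_edges E x. (\<Sum>y\<in>node_cell S.
        (if wrap (x + nu e) = y then 1 else 0) - (if x = y then 1 else 0)) * lam e)"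
    unfolding gen_entry_def gen_def by (subst sum.swap) (simp add: sum_distrib_right)
  also have "\<dots> = 0"
    using x finite_node_cell wrap_target_in_node_cell by (simp add: sum_subtractf)
  finally show ?thesis .
qed

text \<open>
  Translating an edge so that it starts in the unit cell shows that it projects to a transition
  of the quotient chain, unless its two ends are the same node of the quotient.
\<close>

lemma edge_projects_to_transition:
  assumes xy: "(x, y) \<in> E" and ne: "wrap x \<noteq> wrap y"
  shows "(wrap x, wrap y) \<in> transitions (node_cell S) (gen_entry E lam)"
proof -
  have cell: "wrap x \<in> node_cell S" "wrap y \<in> node_cell S"
    using xy edges_subset wrap_in_node_cell by auto
  obtain n where n: "n \<in> int_vecs" "wrap x = x + n"
    by (rule wrap_conv_translate)
  define e where "e = (x + n, y + n)"
  have e: "e \<in> out_edges E (wrap x)"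
    using edges_translate[OF n(1) xy] n(2) by (simp add: out_edges_def e_def)
  have "wrap (wrap x + nu e) = wrap y"
    using wrap_translate[OF n(1), of y] n(2) by (simp add: nu_def e_def algebra_simps)
  then have "0 < (if wrap (wrap x + nu e) = wrap y then lam e else 0)"
    using e lam_pos by (simp add: out_edges_def)
  then have "0 < gen_entry E lam (wrap x) (wrap y)"
    unfolding gen_entry_off_diagonal[OF ne]
    by (intro sum_pos2[OF finite_out_edges[OF cell(1)] e])
       (auto simp: out_edges_def lam_pos less_imp_le)
  then show ?thesis
    using cell ne by (simp add: transitions_def)
qed

lemma path_projects_to_transitions:
  assumes "(x, y) \<in> E\<^sup>*"
  shows "(wrap x, wrap y) \<in> (transitions (node_cell S) (gen_entry E lam))\<^sup>*"
  using assms
proof (induction rule: rtrancl_induct)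
  case (step y z)
  then show ?case
    using edge_projects_to_transition[of y z]
    by (cases "wrap y = wrap z") (auto intro: rtrancl_into_rtrancl)
qed simp

lemma gen_entry_rate_matrix: "rate_matrix (node_cell S) (gen_entry E lam)"
proof
  show "finite (node_cell S)"
    by (rule finite_node_cell)
next
  fix x y :: "real ^ 'd"
  assume "x \<noteq> y"
  then show "0 \<le> gen_entry E lam x y"
    unfolding gen_entry_off_diagonal[OF \<open>x \<noteq> y\<close>]
    by (intro sum_nonneg) (auto simp: out_edges_def lam_pos less_imp_le)
next
  fix x :: "real ^ 'd"
  assume "x \<in> node_cell S"
  then show "(\<Sum>y\<in>node_cell S. gen_entry E lam x y) = 0"
    by (rule gen_entry_row_sum)
next
  fix x y :: "real ^ 'd"
  assume cell: "x \<in> node_cell S" "y \<in> node_cell S"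
  then have "(x, y) \<in> E\<^sup>*"
    using strongly_connected by (auto simp: node_cell_def)
  then show "(x, y) \<in> (transitions (node_cell S) (gen_entry E lam))\<^sup>*"
    using path_projects_to_transitions[of x y] cell by (simp add: wrap_node_cell)
qed

lemma stationary_unique:
  assumes p: "stationary S E lam p" and p': "stationary S E lam p'" and "y \<in> node_cell S"
  shows "p y = p' y"
proof -
  have "p y - p' y = 0"
  proof (rule rate_matrix.left_kernel_sum_zero[OF gen_entry_rate_matrix, where q = "\<lambda>y. p y - p' y"])
    show "(\<Sum>x\<in>node_cell S. gen_entry E lam x y * (p x - p' x)) = 0" if "y \<in> node_cell S" for y
      using p p' that by (simp add: stationary_def gen_transpose_def right_diff_distrib sum_subtractf)
    show "(\<Sum>x\<in>node_cell S. p x - p' x) = 0"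
      using p p' by (simp add: stationary_def sum_subtractf)
  qed fact
  then show ?thesis by simp
qed

end

section \<open>Symmetries and the drift\<close>

lemma stationary_symmetry:
  assumes p: "stationary S E lam p" and sym: "symmetry S E lam \<phi>"
  shows "stationary S E lam (p \<circ> \<phi>)"
proof -
  have bij: "bij_betw \<phi> (node_cell S) (node_cell S)"
    using sym by (simp add: symmetry_def)
  have "gen_transpose S E lam (p \<circ> \<phi>) y = 0" if y: "y \<in> node_cell S" for y
  proof -
    have "gen_transpose S E lam (p \<circ> \<phi>) y =
        (\<Sum>x\<in>node_cell S. gen_entry E lam (\<phi> x) (\<phi> y) * p (\<phi> x))"
      using sym y by (simp add: gen_transpose_def symmetry_def)
    also have "\<dots> = gen_transpose S E lam p (\<phi> y)"
      unfolding gen_transpose_def by (rule sum.reindex_bij_betw[OF bij])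
    also have "\<dots> = 0"
      using p bij_betwE[OF bij] y by (simp add: stationary_def)
    finally show ?thesis .
  qed
  moreover have "(\<Sum>y\<in>node_cell S. p (\<phi> y)) = (\<Sum>y\<in>node_cell S. p y)"
    by (rule sum.reindex_bij_betw[OF bij])
  ultimately show ?thesis
    using p by (simp add: stationary_def)
qed

lemma (in periodic_graph) stationary_sum_antisymmetric:
  assumes p: "stationary S E lam p" and sym: "symmetry S E lam \<phi>"
    and anti: "\<And>y. y \<in> node_cell S \<Longrightarrow> f (\<phi> y) = - f y"
  shows "(\<Sum>y\<in>node_cell S. p y * f y) = 0"
proof -
  have bij: "bij_betw \<phi> (node_cell S) (node_cell S)"
    using sym by (simp add: symmetry_def)
  have invariant: "p (\<phi> y) = p y" if "y \<in> node_cell S" for y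
    using stationary_unique[OF stationary_symmetry[OF p sym] p that] by simp
  have "(\<Sum>y\<in>node_cell S. p y * f y) = (\<Sum>y\<in>node_cell S. p (\<phi> y) * f (\<phi> y))"
    by (rule sum.reindex_bij_betw[OF bij, symmetric])
  also have "\<dots> = - (\<Sum>y\<in>node_cell S. p y * f y)"
    using invariant anti by (simp add: sum_negf)
  finally show ?thesis by simp
qed

theorem theorem4p8:
  fixes S :: "(real ^ 'd) set"
    and E :: "'d edge set"
    and lam :: "'d edge \<Rightarrow> real"
    and \<pi> :: "real ^ 'd \<Rightarrow> real"
  assumes "periodic_graph S E lam"
    and "stationary S E lam \<pi>"
    and "\<And>i::'d. \<exists>\<phi>. symmetry S E lam \<phi> \<and>
           (\<forall>y \<in> node_cell S.
              pullback \<phi> (\<lambda>z. drift E lam z $ i) y = - (drift E lam y $ i)) \<and>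
           (\<forall>y \<in> node_cell S. inv_into (node_cell S) \<phi> y = \<phi> y)"
  shows "(\<Sum>y \<in> node_cell S. \<pi> y *\<^sub>R drift E lam y) = 0"
proof -
  interpret periodic_graph S E lam by fact
  have "(\<Sum>y\<in>node_cell S. \<pi> y * drift E lam y $ i) = 0" for i
  proof -
    obtain \<phi> where sym: "symmetry S E lam \<phi>"
      and anti: "\<forall>y\<in>node_cell S. pullback \<phi> (\<lambda>z. drift E lam z $ i) y = - (drift E lam y $ i)"
      using assms(3) by blast
    show ?thesis
      using anti
      by (intro stationary_sum_antisymmetric[OF assms(2) sym]) (simp add: pullback_def)
  qed
  then show ?thesis
    by (simp add: vec_eq_iff)
qed

end
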